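(* Let $E$ be a Dedekind complete Riesz space and for each $n\in\mathbb N$, $n\ge 1$, let $(x_\alpha(n))_{\alpha\in\Gamma}$ be an increasing net in $E_+^s$, where the directed set $\Gamma$ does not depend on $n$. Put $x(n)=\lim_\alpha x_\alpha(n)$. Then $$\lim_{\alpha}\sum_{n=1}^{\infty}x_\alpha(n)=\sum_{n=1}^{\infty}\lim_{\alpha}x_\alpha(n)=\sum_{n=1}^{\infty}x(n).$$
   Context: $E^s$ denotes the sup-completion of $E$ (in the sense of Donner): the Dedekind complete ordered cone containing $E$ as a solid subcone in which every non-empty subset of $E_+^s$ has a supremum, and every element is the supremum of the elements of $E$ below it. $E^s_+$ is its positive part. The limit of an increasing net in $E^s_+$ is its supremum, and for $z_n\in E_+^s$, $\sum_{n=1}^\infty z_n:=\sup_N\sum_{n=1}^N z_n$ in $E^s$. *)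

theory Defs
  imports Complex_Main
begin

(* A cone has scalar multiplication by nonnegative reals only; "r *\<^sub>R x" is left
   unspecified for r < 0.  There is no cancellation law and there are no inverses. *)
class ordered_cone = ordered_comm_monoid_add + scaleR +
  assumes cone_scaleR_add_right: "0 \<le> r \<Longrightarrow> r *\<^sub>R (x + y) = r *\<^sub>R x + r *\<^sub>R y"
    and cone_scaleR_add_left: "0 \<le> r \<Longrightarrow> 0 \<le> s \<Longrightarrow> (r + s) *\<^sub>R x = r *\<^sub>R x + s *\<^sub>R x"
    and cone_scaleR_scaleR: "0 \<le> r \<Longrightarrow> 0 \<le> s \<Longrightarrow> r *\<^sub>R (s *\<^sub>R x) = (r * s) *\<^sub>R x"
    and cone_scaleR_one: "1 *\<^sub>R x = x"
    and cone_scaleR_zero: "0 *\<^sub>R x = 0"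
    and cone_scaleR_mono: "0 \<le> r \<Longrightarrow> x \<le> y \<Longrightarrow> r *\<^sub>R x \<le> r *\<^sub>R y"

(* The Dedekind complete Riesz space E is the type 'e: an ordered real vector space whose
   order is a conditionally complete lattice.  The Dedekind complete ordered cone E^s is the
   type 's, and emb is the inclusion of E in E^s.  Suprema are over non-empty sets, so that
   E^s has no bottom element unless E has one; emb_below says that the set in sup_below is
   non-empty. *)
locale sup_completion =
  fixes emb :: "'e::{ordered_real_vector, conditionally_complete_lattice}
                  \<Rightarrow> 's::{ordered_cone, conditionally_complete_lattice}"
  assumes emb_add: "emb (a + b) = emb a + emb b"
    and emb_scaleR: "0 \<le> r \<Longrightarrow> emb (r *\<^sub>R a) = r *\<^sub>R emb a"
    and emb_le_iff: "emb a \<le> emb b \<longleftrightarrow> a \<le> b"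
    and solid: "emb a \<le> z \<Longrightarrow> z \<le> emb b \<Longrightarrow> z \<in> range emb"
    and pos_has_sup: "(A :: 's set) \<noteq> {} \<Longrightarrow> (\<forall>z\<in>A. 0 \<le> z) \<Longrightarrow>
          \<exists>s. (\<forall>z\<in>A. z \<le> s) \<and> (\<forall>u. (\<forall>z\<in>A. z \<le> u) \<longrightarrow> s \<le> u)"
    and emb_below: "\<exists>a. emb a \<le> z"
    and sup_below: "(z :: 's) = Sup {y \<in> range emb. y \<le> z}"

(* Meaningful only for an increasing net, respectively a sequence, of nonnegative elements
   of a sup-completion; there the suprema exist by pos_has_sup. *)
definition inc_lim :: "('i \<Rightarrow> 's::conditionally_complete_lattice) \<Rightarrow> 's" where
  "inc_lim x = (SUP \<alpha>. x \<alpha>)"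

definition cone_series :: "(nat \<Rightarrow> 's::{ordered_cone, conditionally_complete_lattice}) \<Rightarrow> 's" where
  "cone_series z = (SUP N\<in>{1..}. \<Sum>n=1..N. z n)"

end

theory Submission
  imports Defs
begin

text \<open>
  Interchanging a limit with a series is an interchange of two suprema as soon as limits of
  increasing nets commute with finite sums, and for this the sum of two suprema has to lie below
  every upper bound of the pairwise sums (\<open>cSup_add_cSup_le\<close>). This sup-continuity of addition is
  not among the axioms of a sup-completion, and it cannot be proved by subtracting, since infinite
  elements do not cancel. It comes from the following argument.

  An element \<open>emb a\<close> does have the inverse \<open>emb (- a)\<close>, so adding it is an order automorphism
  and preserves suprema. Let \<open>u\<close> and \<open>v\<close> both be upper bounds of all sums \<open>emb a + emb b\<close> with
  \<open>emb a \<le> z\<close> and \<open>emb b \<le> w\<close>. With \<open>b\<close> fixed, the supremum over \<open>a\<close> gives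
  \<open>z + emb b \<le> u\<close>; in the same way \<open>emb a + w \<le> v\<close>. Adding the two yields
  \<open>(z + w) + (emb a + emb b) \<le> u + v\<close>. So if \<open>emb e \<le> z + w\<close>, then
  \<open>u + v - emb e\<close> is again an upper bound of the sums. Starting from \<open>u\<close> and applying this
  \<open>n\<close> times with \<open>v = u\<close> gives
  \<open>emb a + emb b + n \<cdot> emb e \<le> (n + 1) \<cdot> u\<close>. After division by \<open>n + 1\<close> the fixed
  term \<open>emb a + emb b\<close> becomes negligible, because a Dedekind complete ordered vector space is
  Archimedean, and \<open>emb e \<le> u\<close> remains. As \<open>z + w\<close> is the supremum of such \<open>emb e\<close>, also
  \<open>z + w \<le> u\<close>.
\<close>

section \<open>The Archimedean property\<close>

text \<open>A supremum \<open>s\<close> of the multiples of \<open>p\<close> satisfies \<open>s \<le> s - p\<close>, because the set of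
  multiples is shifted into itself by \<open>p\<close>.\<close>

lemma archimedean_nonpos:
  fixes p v :: "'a::{ordered_real_vector, conditionally_complete_lattice}"
  assumes bounded: "\<And>n::nat. real n *\<^sub>R p \<le> v"
  shows "p \<le> 0"
proof -
  let ?s = "SUP n::nat. real n *\<^sub>R p"
  have bdd: "bdd_above (range (\<lambda>n::nat. real n *\<^sub>R p))"
    using bounded by (rule bdd_aboveI2)
  have "real n *\<^sub>R p \<le> ?s - p" for n
    using cSUP_upper[OF UNIV_I bdd, of "Suc n"]
    by (simp add: scaleR_add_left le_diff_eq add.commute)
  then have "?s \<le> ?s - p"
    by (intro cSUP_least) auto
  then show ?thesis
    by (simp add: le_diff_eq)
qed

context sup_completion
begin

section \<open>Translations by elements of the Riesz space\<close>

lemma emb_zero: "emb 0 = 0"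
  using emb_scaleR[of 0 0] by (simp add: cone_scaleR_zero)

lemma emb_minus_add_cancel: "emb (- b) + (emb b + y) = y"
  by (simp flip: add.assoc emb_add add: emb_zero)

lemma emb_add_le_iff: "emb b + y \<le> u \<longleftrightarrow> y \<le> emb (- b) + u"
  using add_left_mono[of "emb b + y" u "emb (- b)"] add_left_mono[of y "emb (- b) + u" "emb b"]
    emb_minus_add_cancel[of b y] emb_minus_add_cancel[of "- b" u]
  by auto

lemma le_if_emb_below_le:
  assumes "\<And>a. emb a \<le> z \<Longrightarrow> emb a \<le> u"
  shows "z \<le> u"
  by (subst sup_below, rule cSup_least) (use emb_below[of z] assms in auto)

lemma add_emb_le_if_emb_below_le:
  assumes "\<And>a. emb a \<le> z \<Longrightarrow> emb a + emb b \<le> u"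
  shows "z + emb b \<le> u"
proof -
  have "z \<le> emb (- b) + u"
  proof (rule le_if_emb_below_le)
    fix a assume "emb a \<le> z"
    then have "emb b + emb a \<le> u"
      by (subst add.commute) (rule assms)
    then show "emb a \<le> emb (- b) + u"
      by (simp only: emb_add_le_iff)
  qed
  then have "emb b + z \<le> u"
    by (simp only: emb_add_le_iff)
  then show ?thesis
    by (simp add: add.commute)
qed

section \<open>Sup-continuity of addition\<close>

text \<open>The substitute for cancellation: the sum of two upper bounds leaves room for one
  more copy of \<open>z + w\<close>.\<close>

lemma add_add_emb_le_add_upper_bounds:
  assumes u: "\<And>a b. emb a \<le> z \<Longrightarrow> emb b \<le> w \<Longrightarrow> emb a + emb b \<le> u"
    and v: "\<And>a b. emb a \<le> z \<Longrightarrow> emb b \<le> w \<Longrightarrow> emb a + emb b \<le> v"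
    and a: "emb a \<le> z" and b: "emb b \<le> w"
  shows "(z + w) + (emb a + emb b) \<le> u + v"
proof -
  have "z + emb b \<le> u"
    by (rule add_emb_le_if_emb_below_le) (rule u[OF _ b])
  moreover have "w + emb a \<le> v"
    by (rule add_emb_le_if_emb_below_le) (subst add.commute, rule v[OF a])
  ultimately have "(z + emb b) + (w + emb a) \<le> u + v"
    by (rule add_mono)
  then show ?thesis
    by (simp add: ac_simps)
qed

lemma add_multiple_le_multiple_upper_bound:
  assumes u: "\<And>a b. emb a \<le> z \<Longrightarrow> emb b \<le> w \<Longrightarrow> emb a + emb b \<le> u"
    and e: "emb e \<le> z + w"
    and ab: "emb a \<le> z" "emb b \<le> w"
  shows "emb (real n *\<^sub>R e) + (emb a + emb b) \<le> (real n + 1) *\<^sub>R u"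
  using ab
proof (induction n arbitrary: a b)
  case 0
  then show ?case
    using u by (simp add: emb_zero cone_scaleR_one)
next
  case (Suc n)
  \<comment> \<open>By the induction hypothesis, \<open>v\<close> is an upper bound of the sums as well.\<close>
  let ?v = "emb (- (real n *\<^sub>R e)) + (real n + 1) *\<^sub>R u"
  have "emb e + (emb a + emb b) \<le> (z + w) + (emb a + emb b)"
    using e by (rule add_right_mono)
  also have "\<dots> \<le> u + ?v"
    by (rule add_add_emb_le_add_upper_bounds) (use u Suc in \<open>simp_all flip: emb_add_le_iff\<close>)
  finally have "emb e + (emb a + emb b) \<le> emb (- (real n *\<^sub>R e)) + (u + (real n + 1) *\<^sub>R u)"
    by (simp add: ac_simps)
  then have "emb (real n *\<^sub>R e) + (emb e + (emb a + emb b)) \<le> u + (real n + 1) *\<^sub>R u"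
    by (simp only: emb_add_le_iff)
  moreover have "emb (real (Suc n) *\<^sub>R e) = emb (real n *\<^sub>R e) + emb e"
    by (simp add: scaleR_add_left add.commute flip: emb_add)
  moreover have "(real (Suc n) + 1) *\<^sub>R u = u + (real n + 1) *\<^sub>R u"
    using cone_scaleR_add_left[of 1 "real n + 1" u] by (simp add: cone_scaleR_one ac_simps)
  ultimately show ?case
    by (simp add: add.assoc)
qed

text \<open>The infimum of \<open>emb e\<close> and \<open>u\<close> lies in the Riesz space by solidity; this moves the
  inequalities there, where subtraction and the Archimedean property are available. The condition \<open>c \<le> e\<close> keeps
  the averages of one \<open>c\<close> and \<open>n\<close> copies of \<open>e\<close> below \<open>e\<close>, hence below that infimum.\<close>

lemma emb_le_if_multiples_le:
  assumes le: "\<And>n. emb (c + real n *\<^sub>R e) \<le> (real n + 1) *\<^sub>R u"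
    and "c \<le> e"
  shows "emb e \<le> u"
proof -
  obtain l where "emb l \<le> inf (emb e) u"
    using emb_below by blast
  then obtain q where q: "inf (emb e) u = emb q"
    using solid[of l "inf (emb e) u" e] by auto
  have "real n *\<^sub>R (e - q) \<le> q - c" for n
  proof -
    let ?f = "(1 / (real n + 1)) *\<^sub>R (c + real n *\<^sub>R e)"
    have "c + real n *\<^sub>R e \<le> (real n + 1) *\<^sub>R e"
      using \<open>c \<le> e\<close> by (simp add: scaleR_add_left add.commute)
    then have "?f \<le> (1 / (real n + 1)) *\<^sub>R ((real n + 1) *\<^sub>R e)"
      by (intro scaleR_left_mono) auto
    then have "?f \<le> e"
      by simp
    moreover have "emb ?f \<le> (1 / (real n + 1)) *\<^sub>R ((real n + 1) *\<^sub>R u)"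
      unfolding emb_scaleR[of "1 / (real n + 1)", simplified]
      by (intro cone_scaleR_mono le) auto
    then have "emb ?f \<le> u"
      by (simp add: cone_scaleR_scaleR cone_scaleR_one)
    ultimately have "emb ?f \<le> emb q"
      by (simp add: emb_le_iff flip: q)
    then have "(real n + 1) *\<^sub>R ?f \<le> (real n + 1) *\<^sub>R q"
      by (intro scaleR_left_mono) (auto simp: emb_le_iff)
    then have "c + real n *\<^sub>R e \<le> real n *\<^sub>R q + q"
      by (simp add: scaleR_add_left)
    then show ?thesis
      by (simp add: scaleR_diff_right algebra_simps)
  qed
  then have "e - q \<le> 0"
    by (rule archimedean_nonpos)
  then have "emb e \<le> inf (emb e) u"
    by (simp add: q emb_le_iff)
  then show ?thesis
    by simp
qed

lemma add_le_if_emb_below_le: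
  assumes u: "\<And>a b. emb a \<le> z \<Longrightarrow> emb b \<le> w \<Longrightarrow> emb a + emb b \<le> u"
  shows "z + w \<le> u"
proof (rule le_if_emb_below_le)
  fix e assume e: "emb e \<le> z + w"
  obtain a' b where a': "emb a' \<le> z" and b: "emb b \<le> w"
    using emb_below by blast
  \<comment> \<open>Lowering \<open>a'\<close> makes the fixed sum \<open>a + b\<close> lie below \<open>e\<close>.\<close>
  define a where "a = inf a' (e - b)"
  have "emb a \<le> emb a'"
    by (simp add: a_def emb_le_iff)
  with a' have a: "emb a \<le> z"
    by simp
  have "a + b \<le> e"
    by (simp add: a_def flip: le_diff_eq)
  moreover have "emb ((a + b) + real n *\<^sub>R e) \<le> (real n + 1) *\<^sub>R u" for n
    using add_multiple_le_multiple_upper_bound[OF u e a b, of n]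
    by (simp add: emb_add ac_simps)
  ultimately show "emb e \<le> u"
    by (rule emb_le_if_multiples_le[rotated])
qed

text \<open>Adding an \<open>emb a\<close> with \<open>emb a \<le> x\<close> preserves the supremum of \<open>A\<close>, and by
  \<open>add_le_if_emb_below_le\<close> such translations determine \<open>x + Sup A\<close>.\<close>

lemma add_cSup_le:
  fixes A :: "'s set"
  assumes "A \<noteq> {}"
    and u: "\<And>y. y \<in> A \<Longrightarrow> x + y \<le> u"
  shows "x + Sup A \<le> u"
proof (rule add_le_if_emb_below_le)
  fix a b assume a: "emb a \<le> x" and b: "emb b \<le> Sup A"
  have "emb a + y \<le> u" if "y \<in> A" for y
    using add_right_mono[OF a] u[OF that] by (rule order_trans)
  then have "Sup A \<le> emb (- a) + u"
    using \<open>A \<noteq> {}\<close> by (intro cSup_least) (simp_all flip: emb_add_le_iff)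
  with b have "emb b \<le> emb (- a) + u"
    by (rule order_trans)
  then show "emb a + emb b \<le> u"
    by (simp only: emb_add_le_iff)
qed

lemma cSup_add_cSup_le:
  fixes A B :: "'s set"
  assumes "A \<noteq> {}" and "B \<noteq> {}"
    and u: "\<And>x y. x \<in> A \<Longrightarrow> y \<in> B \<Longrightarrow> x + y \<le> u"
  shows "Sup A + Sup B \<le> u"
proof -
  have "Sup B + x \<le> u" if "x \<in> A" for x
    using add_cSup_le[OF \<open>B \<noteq> {}\<close> u] that by (simp add: add.commute)
  then have "Sup B + Sup A \<le> u"
    by (rule add_cSup_le[OF \<open>A \<noteq> {}\<close>])
  then show ?thesis
    by (simp add: add.commute)
qed

section \<open>Limits of increasing nets and series\<close>

lemma bdd_above_if_nonneg:
  fixes A :: "'s set"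
  assumes "\<And>z. z \<in> A \<Longrightarrow> 0 \<le> z"
  shows "bdd_above A"
  using pos_has_sup[of A] assms by (cases "A = {}") (auto intro: bdd_aboveI)

lemma le_inc_lim:
  fixes f :: "'i \<Rightarrow> 's"
  assumes "\<And>\<alpha>. 0 \<le> f \<alpha>"
  shows "f \<alpha> \<le> inc_lim f"
  unfolding inc_lim_def using assms by (intro cSUP_upper bdd_above_if_nonneg) auto

lemma inc_lim_least:
  fixes f :: "'i \<Rightarrow> 's"
  assumes "\<And>\<alpha>. f \<alpha> \<le> u"
  shows "inc_lim f \<le> u"
  unfolding inc_lim_def using assms by (intro cSUP_least) auto

lemma partial_sum_le_cone_series:
  fixes z :: "nat \<Rightarrow> 's"
  assumes "\<And>n. n \<ge> 1 \<Longrightarrow> 0 \<le> z n" and "N \<ge> 1"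
  shows "(\<Sum>n=1..N. z n) \<le> cone_series z"
  unfolding cone_series_def using assms
  by (intro cSUP_upper bdd_above_if_nonneg) (auto intro!: sum_nonneg)

lemma cone_series_least:
  fixes z :: "nat \<Rightarrow> 's"
  assumes "\<And>N. N \<ge> 1 \<Longrightarrow> (\<Sum>n=1..N. z n) \<le> u"
  shows "cone_series z \<le> u"
  unfolding cone_series_def using assms by (intro cSUP_least) auto

lemma cone_series_nonneg:
  fixes z :: "nat \<Rightarrow> 's"
  assumes "\<And>n. n \<ge> 1 \<Longrightarrow> 0 \<le> z n"
  shows "0 \<le> cone_series z"
  using order_trans[OF assms[of 1], of "cone_series z"] partial_sum_le_cone_series[of z 1] assms
  by simp

lemma cone_series_mono:
  fixes y z :: "nat \<Rightarrow> 's"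
  assumes nonneg: "\<And>n. n \<ge> 1 \<Longrightarrow> 0 \<le> y n"
    and le: "\<And>n. n \<ge> 1 \<Longrightarrow> y n \<le> z n"
  shows "cone_series y \<le> cone_series z"
proof (rule cone_series_least)
  fix N :: nat assume "N \<ge> 1"
  have "0 \<le> z n" if "n \<ge> 1" for n
    using nonneg[OF that] le[OF that] by (rule order_trans)
  then have "(\<Sum>n=1..N. z n) \<le> cone_series z"
    using \<open>N \<ge> 1\<close> by (intro partial_sum_le_cone_series)
  moreover have "(\<Sum>n=1..N. y n) \<le> (\<Sum>n=1..N. z n)"
    using le by (intro sum_mono) auto
  ultimately show "(\<Sum>n=1..N. y n) \<le> cone_series z"
    by (rule order_trans[rotated])
qed

text \<open>Directedness turns the double supremum over \<open>f \<alpha> + g \<beta>\<close> into the supremum along the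
  diagonal.\<close>

lemma inc_lim_add_le:
  fixes f g :: "'i::preorder \<Rightarrow> 's"
  assumes directed: "\<And>\<alpha> \<beta> :: 'i. \<exists>\<gamma>. \<alpha> \<le> \<gamma> \<and> \<beta> \<le> \<gamma>"
    and f: "\<And>\<alpha> \<beta>. \<alpha> \<le> \<beta> \<Longrightarrow> f \<alpha> \<le> f \<beta>"
    and g: "\<And>\<alpha> \<beta>. \<alpha> \<le> \<beta> \<Longrightarrow> g \<alpha> \<le> g \<beta>"
    and nonneg: "\<And>\<alpha>. 0 \<le> f \<alpha> + g \<alpha>"
  shows "inc_lim f + inc_lim g \<le> inc_lim (\<lambda>\<alpha>. f \<alpha> + g \<alpha>)"
proof -
  have "f \<alpha> + g \<beta> \<le> inc_lim (\<lambda>\<alpha>. f \<alpha> + g \<alpha>)" for \<alpha> \<beta>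
  proof -
    obtain \<gamma> where \<gamma>: "\<alpha> \<le> \<gamma>" "\<beta> \<le> \<gamma>"
      using directed by blast
    have "f \<alpha> + g \<beta> \<le> f \<gamma> + g \<gamma>"
      using f g \<gamma> by (intro add_mono)
    also have "\<dots> \<le> inc_lim (\<lambda>\<alpha>. f \<alpha> + g \<alpha>)"
      using nonneg by (rule le_inc_lim)
    finally show ?thesis .
  qed
  then have "(SUP \<alpha>. f \<alpha>) + (SUP \<alpha>. g \<alpha>) \<le> inc_lim (\<lambda>\<alpha>. f \<alpha> + g \<alpha>)"
    by (intro cSup_add_cSup_le) auto
  then show ?thesis
    by (simp add: inc_lim_def)
qed

lemma sum_inc_lim_le:
  fixes f :: "'a \<Rightarrow> 'i::preorder \<Rightarrow> 's"
  assumes directed: "\<And>\<alpha> \<beta> :: 'i. \<exists>\<gamma>. \<alpha> \<le> \<gamma> \<and> \<beta> \<le> \<gamma>"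
    and "finite I"
    and nonneg: "\<And>i \<alpha>. i \<in> I \<Longrightarrow> 0 \<le> f i \<alpha>"
    and mono: "\<And>i \<alpha> \<beta>. i \<in> I \<Longrightarrow> \<alpha> \<le> \<beta> \<Longrightarrow> f i \<alpha> \<le> f i \<beta>"
  shows "(\<Sum>i\<in>I. inc_lim (f i)) \<le> inc_lim (\<lambda>\<alpha>. \<Sum>i\<in>I. f i \<alpha>)"
  using \<open>finite I\<close> nonneg mono
proof (induction I rule: finite_induct)
  case empty
  show ?case
    by (simp add: inc_lim_def)
next
  case (insert j I)
  have "(\<Sum>i\<in>insert j I. inc_lim (f i)) \<le> inc_lim (f j) + inc_lim (\<lambda>\<alpha>. \<Sum>i\<in>I. f i \<alpha>)"
    using insert by (simp add: add_left_mono)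
  also have "\<dots> \<le> inc_lim (\<lambda>\<alpha>. f j \<alpha> + (\<Sum>i\<in>I. f i \<alpha>))"
    using insert.prems
    by (intro inc_lim_add_le directed sum_mono add_nonneg_nonneg sum_nonneg) auto
  also have "\<dots> = inc_lim (\<lambda>\<alpha>. \<Sum>i\<in>insert j I. f i \<alpha>)"
    using insert.hyps by simp
  finally show ?case .
qed

lemma inc_lim_cone_series:
  fixes f :: "nat \<Rightarrow> 'i::preorder \<Rightarrow> 's"
  assumes directed: "\<And>\<alpha> \<beta> :: 'i. \<exists>\<gamma>. \<alpha> \<le> \<gamma> \<and> \<beta> \<le> \<gamma>"
    and nonneg: "\<And>n \<alpha>. n \<ge> 1 \<Longrightarrow> 0 \<le> f n \<alpha>"
    and mono: "\<And>n \<alpha> \<beta>. n \<ge> 1 \<Longrightarrow> \<alpha> \<le> \<beta> \<Longrightarrow> f n \<alpha> \<le> f n \<beta>"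
  shows "inc_lim (\<lambda>\<alpha>. cone_series (\<lambda>n. f n \<alpha>)) = cone_series (\<lambda>n. inc_lim (f n))"
proof (rule antisym)
  show "inc_lim (\<lambda>\<alpha>. cone_series (\<lambda>n. f n \<alpha>)) \<le> cone_series (\<lambda>n. inc_lim (f n))"
    using nonneg by (intro inc_lim_least cone_series_mono le_inc_lim)
next
  let ?L = "inc_lim (\<lambda>\<alpha>. cone_series (\<lambda>n. f n \<alpha>))"
  show "cone_series (\<lambda>n. inc_lim (f n)) \<le> ?L"
  proof (rule cone_series_least)
    fix N :: nat assume "N \<ge> 1"
    have "(\<Sum>n=1..N. inc_lim (f n)) \<le> inc_lim (\<lambda>\<alpha>. \<Sum>n=1..N. f n \<alpha>)"
      using nonneg mono by (intro sum_inc_lim_le directed) auto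
    also have "\<dots> \<le> ?L"
    proof (rule inc_lim_least)
      fix \<alpha>
      have "(\<Sum>n=1..N. f n \<alpha>) \<le> cone_series (\<lambda>n. f n \<alpha>)"
        using nonneg \<open>N \<ge> 1\<close> by (intro partial_sum_le_cone_series)
      also have "\<dots> \<le> ?L"
        using nonneg by (intro le_inc_lim[where f = "\<lambda>\<alpha>. cone_series (\<lambda>n. f n \<alpha>)"] cone_series_nonneg)
      finally show "(\<Sum>n=1..N. f n \<alpha>) \<le> ?L" .
    qed
    finally show "(\<Sum>n=1..N. inc_lim (f n)) \<le> ?L" .
  qed
qed

end

theorem theorem10:
  fixes emb :: "'e::{ordered_real_vector, conditionally_complete_lattice}
                  \<Rightarrow> 's::{ordered_cone, conditionally_complete_lattice}"
    and xa :: "nat \<Rightarrow> 'i::preorder \<Rightarrow> 's"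
    and x :: "nat \<Rightarrow> 's"
  assumes "sup_completion emb"
    and directed: "\<And>\<alpha> \<beta> :: 'i. \<exists>\<gamma>. \<alpha> \<le> \<gamma> \<and> \<beta> \<le> \<gamma>"
    and nonneg: "\<And>n \<alpha>. n \<ge> 1 \<Longrightarrow> 0 \<le> xa n \<alpha>"
    and increasing: "\<And>n \<alpha> \<beta>. n \<ge> 1 \<Longrightarrow> \<alpha> \<le> \<beta> \<Longrightarrow> xa n \<alpha> \<le> xa n \<beta>"
    and x_def: "\<And>n. n \<ge> 1 \<Longrightarrow> x n = inc_lim (\<lambda>\<alpha>. xa n \<alpha>)"
  shows "inc_lim (\<lambda>\<alpha>. cone_series (\<lambda>n. xa n \<alpha>)) = cone_series (\<lambda>n. inc_lim (\<lambda>\<alpha>. xa n \<alpha>))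
       \<and> cone_series (\<lambda>n. inc_lim (\<lambda>\<alpha>. xa n \<alpha>)) = cone_series x"
proof
  interpret sup_completion emb by fact
  show "inc_lim (\<lambda>\<alpha>. cone_series (\<lambda>n. xa n \<alpha>)) = cone_series (\<lambda>n. inc_lim (\<lambda>\<alpha>. xa n \<alpha>))"
    using directed nonneg increasing by (rule inc_lim_cone_series)
  show "cone_series (\<lambda>n. inc_lim (\<lambda>\<alpha>. xa n \<alpha>)) = cone_series x"
    unfolding cone_series_def using x_def by (intro SUP_cong sum.cong) auto
qed

end
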